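(* For all real $t \geq 1$ let $\mathcal{D}(t) := \sum_{n \leq t}\sigma(n) - \frac{t^2 \zeta(2)}{2}$. Then the improper integral $\int_1^{\infty} \frac{\mathcal{D}(t) + t/2}{t^{2}} \, \mathrm{d}t$ converges, and $$\int_1^{\infty} \frac{\mathcal{D}(t) + t/2}{t^{2}} \, \mathrm{d}t = \frac{1}{2} \left( 1 + \zeta(2) - \gamma - \log 2\pi \right).$$
   Context: $\sigma(n) = \sum_{d \mid n} d$ is the sum-of-divisors function, $\zeta$ is the Riemann zeta function, $\gamma$ is Euler's constant; sums $\sum_{n\le t}$ run over positive integers $n \le t$. Convergence of the improper integral means that $\int_1^X$ has a finite limit as $X \to \infty$, and the integral denotes this limit. *)

theory Defs
  imports "HOL-Analysis.Analysis"
begin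

text \<open>The value at \<open>n = 0\<close> is junk: the set of divisors of \<open>0\<close> is infinite.\<close>
definition sigma :: "nat \<Rightarrow> nat" where
  "sigma n = (\<Sum>d | d dvd n. d)"

text \<open>
  The Riemann zeta function on the real half-line \<open>s > 1\<close>, where it is given by its Dirichlet
  series; no analytic continuation is provided. The term with index \<open>n\<close> is \<open>1 / (n + 1)\<^sup>s\<close>.
\<close>
definition zeta :: "real \<Rightarrow> real" where
  "zeta s = (\<Sum>n. 1 / real (Suc n) powr s)"

definition sigma_error :: "real \<Rightarrow> real" where
  "sigma_error t = (\<Sum>n | 1 \<le> n \<and> real n \<le> t. real (sigma n)) - t\<^sup>2 * zeta 2 / 2"

text \<open>
  Both parts are needed: \<^const>\<open>integral\<close> is \<open>0\<close> for a non-integrable function, so the limit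
  alone would not say that the integrals over \<open>[a, X]\<close> exist.
\<close>
definition has_improper_integral :: "(real \<Rightarrow> real) \<Rightarrow> real \<Rightarrow> real \<Rightarrow> bool" where
  "has_improper_integral f a I \<longleftrightarrow>
     (\<forall>X\<ge>a. f integrable_on {a..X}) \<and> ((\<lambda>X. integral {a..X} f) \<longlongrightarrow> I) at_top"

end

theory Submission
  imports Defs "HOL-Real_Asymp.Real_Asymp"
begin

text \<open>
  Integrating \<open>1/t\<^sup>2\<close> against the step function \<open>\<Sum>n\<le>t. \<sigma>(n)\<close> over \<open>[1, X]\<close> gives
  \<open>\<Sum>n\<le>X. \<sigma>(n) (1/n - 1/X)\<close>, which equals \<open>\<Sum>dm\<le>X. f(d)\<close> for \<open>f(d) = 1/d - d/X\<close>. The hyperbola method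
  at \<open>N = \<lfloor>\<surd>X\<rfloor>\<close> turns this into
  \<open>(\<Sum>m\<le>N. f(m) \<lfloor>X/m\<rfloor> + F(X/m)) - N F(N)\<close> with \<open>F(z) = \<Sum>d\<le>z. f(d)\<close>. Neither \<open>\<Sum>\<sigma>(n)/n\<close> nor
  \<open>\<Sum>\<sigma>(n)\<close> alone has an elementary error term of the required quality, but in this combination the
  sawtooth functions of \<open>X/m\<close> in the two inner terms cancel exactly. What remains is a smooth sum over
  \<open>m \<le> N\<close>, evaluated by Stirling's formula and the expansions of \<open>\<Sum>1/m\<close> and \<open>\<Sum>1/m\<^sup>2\<close>.
\<close>

section \<open>Stirling's formula\<close>

text \<open>The sequence decreases, with decrements dominated by a telescoping series, so it
  converges to some \<open>L\<close>. Comparing the indices \<open>n\<close> and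
  \<open>2 * n\<close> through Wallis' product identifies \<open>L\<close>.\<close>

lemma tendsto_ln_fact_stirling:
  "(\<lambda>n. ln (fact n) - (n + 1/2) * ln (real n) + n) \<longlonglongrightarrow> ln (2 * pi) / 2"
proof -
  define s where "s n = ln (fact n) - (real n + 1/2) * ln (real n) + real n" for n :: nat
  have step: "s (Suc n) \<le> s n \<and> s n - s (Suc n) \<le> (1 / n - 1 / Suc n) / 4" if "n \<ge> 1" for n
  proof -
    have n: "real n > 0" using that by simp
    have lf: "ln (fact (Suc n)) = ln (real n + 1) + ln (fact n :: real)"
      using n by (simp add: ln_mult add.commute)
    have eq: "s n - s (Suc n) = (n + 1/2) * (ln (real n + 1) - ln n) - 1"
      unfolding s_def lf by (simp add: algebra_simps)
    \<comment> \<open>Since 1/x is convex, its integral over [n, n + 1] lies between the midpoint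
      and the trapezoid value. The midpoint value cancels the \<open>- 1\<close> in
      \<open>eq\<close> exactly; the excess of the trapezoid value is the telescoping term.\<close>
    have ge: "ln (real n + 1) - ln n \<ge> 2 / (2 * n + 1)"
      using ln_inverse_approx_ge[of "real n" "real n + 1"] n by (simp add: add_ac)
    have le: "ln (real n + 1) - ln n \<le> (1 / n + 1 / (n + 1)) / 2"
      using ln_inverse_approx_le[of "real n" 1] n by (simp add: inverse_eq_divide add_ac)
    have "(n + 1/2) * (2 / (2 * n + 1)) \<le> (n + 1/2) * (ln (real n + 1) - ln n)"
      using ge n by (intro mult_left_mono) auto
    moreover have "(n + 1/2) * (2 / (2 * n + 1)) = (1 :: real)"
      using n by (simp add: field_simps)
    moreover have "(n + 1/2) * (ln (real n + 1) - ln n) \<le> (n + 1/2) * ((1 / n + 1 / (n + 1)) / 2)"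
      using le n by (intro mult_left_mono) auto
    moreover have "(n + 1/2) * ((1 / n + 1 / (n + 1)) / 2) = 1 + (1 / n - 1 / Suc n) / 4"
      using n by (simp add: divide_simps) (simp add: algebra_simps)
    ultimately show ?thesis using eq by linarith
  qed
  \<comment> \<open>From index 1 on, \<open>s n - 1 / n / 4\<close> increases, which bounds
    \<open>s\<close> from below.\<close>
  have lower: "s 1 - 1/4 \<le> s (Suc n) - 1 / Suc n / 4" for n
  proof (induction n)
    case (Suc n)
    from Suc step[of "Suc n"] show ?case by (simp add: diff_divide_distrib del: of_nat_Suc)
  qed simp
  have "decseq (\<lambda>n. s (Suc n))"
    using step by (intro decseq_SucI) simp
  moreover have "s 1 - 1/4 \<le> s (Suc n)" for n
    using lower[of n] by (smt (verit) divide_nonneg_nonneg of_nat_0_le_iff)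
  ultimately obtain L where "(\<lambda>n. s (Suc n)) \<longlonglongrightarrow> L"
    using decseq_convergent by blast
  hence s: "s \<longlonglongrightarrow> L" by (simp only: filterlim_sequentially_Suc)
  have s2: "(\<lambda>n. s (2 * n)) \<longlonglongrightarrow> L"
    using LIMSEQ_subseq_LIMSEQ[OF s, of "\<lambda>n. 2 * n"] by (simp add: strict_mono_def o_def)
  define W where "W n = (\<Prod>k=1..n. (4 * real k^2) / (4 * real k^2 - 1))" for n
  have W: "W n = 2 ^ (4 * n) * fact n ^ 4 / (fact (2 * n) ^ 2 * real (2 * n + 1))" for n
  proof (induction n)
    case (Suc n)
    have "W (Suc n) = W n * (4 * real (Suc n)^2 / (4 * real (Suc n)^2 - 1))"
      by (simp add: W_def)
    also have "4 * real (Suc n)^2 - 1 = (2 * n + 1) * (2 * n + 3)"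
      by (simp add: power2_eq_square algebra_simps)
    also have "W n * (4 * real (Suc n)^2 / ((2 * n + 1) * (2 * n + 3))) =
      2 ^ (4 * Suc n) * fact (Suc n) ^ 4 / (fact (2 * Suc n) ^ 2 * real (2 * Suc n + 1))"
    proof -
      \<comment> \<open>Used with \<open>F = fact n\<close>, \<open>G = fact (2 * n)\<close>,
        \<open>p = 2 * n + 1\<close>, \<open>q = 2 * n + 3\<close>, \<open>u = n + 1\<close> and
        \<open>a = 2 ^ (4 * n)\<close>; abstract variables keep the factorials from being
        unfolded.\<close>
      have mono: "a * F ^ 4 / (G ^ 2 * p) * (4 * u ^ 2 / (p * q)) =
          16 * a * (u * F) ^ 4 / ((2 * u * (p * G)) ^ 2 * q)"
        if "F > 0" "G > 0" "p > 0" "q > 0" "u > 0" for a F G p q u :: real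
        using that by (simp add: divide_simps power_mult_distrib) (simp add: eval_nat_numeral)
      have "fact (2 * Suc n) = 2 * real (Suc n) * ((2 * real n + 1) * fact (2 * n))"
        by (simp add: algebra_simps)
      moreover have "fact (Suc n) = real (Suc n) * fact n" by simp
      moreover have "real (2 * n + 1) = 2 * real n + 1" "real (2 * Suc n + 1) = 2 * real n + 3"
        "real (2 * n + 3) = 2 * real n + 3" by simp_all
      moreover have "(2 :: real) ^ (4 * Suc n) = 16 * 2 ^ (4 * n)" by (simp add: power_add)
      ultimately show ?thesis
        unfolding Suc.IH by (simp only: of_nat_mult) (rule mono; simp)
    qed
    finally show ?case .
  qed (simp add: W_def)
  \<comment> \<open>In \<open>4 * s n - 2 * s (2 * n)\<close> the terms of order n ln n and n
    cancel. The remaining quotient tends to 1/4, so Wallis gives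
    \<open>2 * L + ln (1/4) = ln (pi / 2)\<close>.\<close>
  have lnW: "ln (W n) = 4 * s n - 2 * s (2 * n) + ln (real n / (2 * (2 * real n + 1)))" if "n \<ge> 1" for n
  proof -
    have n: "real n > 0" using that by simp
    have "ln (W n) = 4 * n * ln 2 + 4 * ln (fact n) - 2 * ln (fact (2 * n)) - ln (2 * n + 1)"
      unfolding W using n by (simp add: ln_mult ln_div ln_realpow)
    moreover have "ln (real n / (2 * (2 * real n + 1))) = ln n - ln 2 - ln (2 * n + 1)"
      using n by (subst ln_div; (subst ln_mult)?; simp add: add_ac)
    moreover have "ln (real (2 * n)) = ln 2 + ln n" using n by (simp add: ln_mult)
    ultimately show ?thesis unfolding s_def by (simp add: algebra_simps)
  qed
  have lim: "(\<lambda>n. real n / (2 * (2 * real n + 1))) \<longlonglongrightarrow> 1/4" by real_asymp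
  hence "(\<lambda>n. 4 * s n - 2 * s (2 * n) + ln (real n / (2 * (2 * real n + 1)))) \<longlonglongrightarrow> 4 * L - 2 * L + ln (1/4)"
    by (intro tendsto_add tendsto_diff tendsto_mult tendsto_const tendsto_ln s s2 lim) simp
  moreover have "eventually (\<lambda>n. 4 * s n - 2 * s (2 * n) + ln (real n / (2 * (2 * real n + 1))) = ln (W n)) sequentially"
    using lnW by (intro eventually_sequentiallyI[of 1]) simp
  ultimately have "(\<lambda>n. ln (W n)) \<longlonglongrightarrow> 2 * L + ln (1/4)"
    by (subst (asm) tendsto_cong) (auto simp: algebra_simps)
  moreover have "(\<lambda>n. ln (W n)) \<longlonglongrightarrow> ln (pi / 2)"
    unfolding W_def by (intro tendsto_ln wallis) simp
  ultimately have "2 * L + ln (1/4) = ln (pi / 2)" by (rule LIMSEQ_unique)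
  moreover have "ln (2 * pi) = ln (pi / 2) - ln (1/4)"
    using ln_div[of "pi / 2" "1 / 4"] by (simp add: mult.commute)
  ultimately have L: "L = ln (2 * pi) / 2" by simp
  show ?thesis using s unfolding s_def L .
qed

section \<open>Partial sums of the series for zeta(2)\<close>

lemma zeta_2_sums: "(\<lambda>n. 1 / real (Suc n) ^ 2) sums zeta 2"
proof -
  have "summable (\<lambda>n. 1 / real (Suc n) ^ 2)"
    using sums_summable[OF inverse_squares_sums] by (simp add: add_ac)
  hence "(\<lambda>n. 1 / real (Suc n) ^ 2) sums (\<Sum>n. 1 / real (Suc n) ^ 2)" by (rule summable_sums)
  thus ?thesis unfolding zeta_def by (simp del: of_nat_Suc)
qed

text \<open>The terms \<open>1 / N - 1 / (2 * N ^ 2)\<close> are the leading Euler-Maclaurin terms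
  of the tail. Adding them to the partial sums gives an increasing sequence with limit
  \<open>zeta 2\<close> whose increments are dominated by the differences of
  \<open>1 / n ^ 3\<close>.\<close>

lemma zeta_2_tail_bound:
  assumes "N \<ge> 1"
  shows "\<bar>(\<Sum>m=1..N. 1 / real m ^ 2) - zeta 2 + 1 / N - 1 / (2 * N ^ 2)\<bar> \<le> 1 / N ^ 3"
proof -
  define b where "b n = (\<Sum>m=1..n. 1 / real m ^ 2) + 1 / n - 1 / (2 * n ^ 2)" for n :: nat
  have incr: "b n \<le> b (Suc n) \<and> b (Suc n) - b n \<le> 1 / n ^ 3 - 1 / real (Suc n) ^ 3" if "n \<ge> 1" for n
  proof -
    have n: "real n > 0" using that by simp
    have "b (Suc n) - b n = 1 / (n + 1)^2 + 1 / (n + 1) - 1 / (2 * (n + 1)^2) - 1 / n + 1 / (2 * n^2)"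
      by (simp add: b_def add_ac)
    also have "\<dots> = 1 / (2 * n ^ 2 * (n + 1) ^ 2)"
      using n by (simp add: divide_simps add_pos_pos) algebra
    finally have eq: "b (Suc n) - b n = 1 / (2 * n ^ 2 * (n + 1) ^ 2)" .
    have "1 / n ^ 3 - 1 / real (Suc n) ^ 3 = (3 * n ^ 2 + 3 * n + 1) / (n ^ 3 * (n + 1) ^ 3)"
      using n by (simp add: divide_simps add_pos_pos) algebra
    also have "\<dots> \<ge> (n * (n + 1) / 2) / (n ^ 3 * (n + 1) ^ 3)"
      using n by (intro divide_right_mono) (auto simp: power2_eq_square algebra_simps)
    also have "(n * (n + 1) / 2) / (n ^ 3 * (n + 1) ^ 3) = 1 / (2 * n ^ 2 * (n + 1) ^ 2)"
      using n by (simp add: divide_simps add_pos_pos) algebra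
    finally have "b (Suc n) - b n \<le> 1 / n ^ 3 - 1 / real (Suc n) ^ 3" unfolding eq .
    moreover have "b (Suc n) - b n \<ge> 0" unfolding eq by simp
    ultimately show ?thesis by simp
  qed
  have "(\<lambda>n. \<Sum>m=1..n. 1 / real m ^ 2) \<longlonglongrightarrow> zeta 2"
    using zeta_2_sums by (simp add: sums_def sum.atLeast1_atMost_eq lessThan_Suc_atMost)
  moreover have "(\<lambda>n. 1 / real n - 1 / (2 * real n ^ 2)) \<longlonglongrightarrow> 0" by real_asymp
  ultimately have "(\<lambda>n. (\<Sum>m=1..n. 1 / real m ^ 2) + (1 / real n - 1 / (2 * real n ^ 2))) \<longlonglongrightarrow> zeta 2 + 0"
    by (rule tendsto_add)
  hence b: "b \<longlonglongrightarrow> zeta 2" by (simp add: b_def [abs_def] algebra_simps)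
  have mono: "b N \<le> b n \<and> b n - b N \<le> 1 / N ^ 3 - 1 / real n ^ 3" if "n \<ge> N" for n
    using that
  proof (induction n rule: dec_induct)
    case (step n)
    thus ?case using incr[of n] assms by linarith
  qed simp
  have "b N \<le> zeta 2"
    by (rule LIMSEQ_le_const[OF b]) (use mono in blast)
  moreover have "zeta 2 \<le> b N + 1 / N ^ 3"
  proof (rule LIMSEQ_le_const2[OF b], intro exI allI impI)
    fix n assume "N \<le> n"
    have "1 / real n ^ 3 \<ge> 0" by simp
    thus "b n \<le> b N + 1 / N ^ 3" using mono[OF \<open>N \<le> n\<close>] by linarith
  qed
  ultimately show ?thesis unfolding b_def by (simp add: abs_le_iff)
qed

section \<open>Expansions at an integer part, with their sawtooth terms\<close>

text \<open>The two-sided bounds for Euler's constant apply with \<open>ln (n + 1)\<close>. Moving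
  the logarithm from \<open>n + 1\<close> to \<open>z\<close> produces the sawtooth term to first
  order and leaves a quadratic error.\<close>

lemma harm_floor_bound:
  assumes "n \<ge> 1" "real n \<le> z" "z < real n + 1"
  shows "\<bar>harm n - ln z - euler_mascheroni + (z - n - 1/2) / z\<bar> \<le> 2 / z ^ 2"
proof -
  have z: "z > 0" using assms by linarith
  have n: "real n \<ge> 1" using assms by simp
  define t where "t = harm n - ln (real n + 1) - euler_mascheroni + 1 / (2 * (real n + 1))"
  have t: "t \<le> 0" "t \<ge> - (1 / (2 * n) - 1 / (2 * (n + 1)))"
    using euler_mascheroni_bounds[OF assms(1)] unfolding t_def
    by (simp_all add: inverse_eq_divide add_ac)
  have nz: "z ^ 2 \<le> 2 * n * (n + 1)"
  proof -
    \<comment> \<open>Here \<open>z < n + 1 \<le> 2 * n\<close>, as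
      \<open>n \<ge> 1\<close>.\<close>
    have "z * z \<le> (2 * real n) * (n + 1)"
      by (rule mult_mono) (use assms n z in auto)
    thus ?thesis by (simp add: power2_eq_square algebra_simps)
  qed
  have "1 / (2 * real n) - 1 / (2 * (n + 1)) = 1 / (2 * n * (n + 1))"
    using n by (simp add: field_simps)
  also have "\<dots> \<le> 1 / z ^ 2"
    using nz z assms(1) by (intro divide_left_mono mult_pos_pos) (simp_all del: of_nat_mult of_nat_add)
  finally have t': "\<bar>t\<bar> \<le> 1 / z ^ 2" using t by linarith
  define u where "u = (n + 1 - z) / z"
  have u: "u \<ge> 0" "u \<le> 1 / z" unfolding u_def using assms z by (auto simp: divide_simps)
  have "z \<ge> 1" using assms n by linarith
  hence "1 / z \<le> 1" by simp
  with u have "u \<le> 1" by linarith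
  have lnu: "ln (real n + 1) = ln z + ln (1 + u)"
  proof -
    have "real n + 1 = z * (1 + u)" unfolding u_def using z by (simp add: field_simps)
    thus ?thesis using z u by (simp add: ln_mult)
  qed
  have "\<bar>ln (1 + u) - u\<bar> \<le> u ^ 2"
    using abs_ln_one_plus_x_minus_x_bound_nonneg u(1) \<open>u \<le> 1\<close> by blast
  moreover have "ln (1 + u) \<le> u" using u(1) ln_add_one_self_le_self by blast
  moreover have "u ^ 2 \<le> 1 / z ^ 2"
    using power_mono[OF u(2) u(1), of 2] by (simp add: power_divide)
  ultimately have v: "ln (1 + u) - u \<le> 0" "ln (1 + u) - u \<ge> - (1 / z ^ 2)" by linarith+
  define w where "w = (n + 1 - z) / (2 * z * (n + 1))"
  have w: "0 \<le> w" "w \<le> 1 / z ^ 2"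
  proof -
    show "0 \<le> w" unfolding w_def using assms z by simp
    have "w \<le> 1 / (2 * z * (n + 1))" unfolding w_def using assms z by (intro divide_right_mono) auto
    also have "\<dots> \<le> 1 / z ^ 2" using assms z by (intro divide_left_mono) (auto simp: power2_eq_square)
    finally show "w \<le> 1 / z ^ 2" .
  qed
  \<comment> \<open>Each of the three errors is at most \<open>1 / z ^ 2\<close> in size. The
    logarithmic one is nonpositive and \<open>w\<close> is nonnegative, so the constant 2
    suffices.\<close>
  have "harm n - ln z - euler_mascheroni + (z - n - 1/2) / z = t + (ln (1 + u) - u) + w"
  proof -
    have "u - 1 / (2 * (real n + 1)) + (z - n - 1/2) / z = w"
      unfolding u_def w_def using n z by (simp add: divide_simps) (simp add: algebra_simps)
    thus ?thesis unfolding t_def lnu by linarith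
  qed
  moreover have "2 / z ^ 2 = 1 / z ^ 2 + 1 / z ^ 2" by simp
  ultimately show ?thesis using t' v w by linarith
qed

text \<open>Completing the square: with \<psi> = z - n - 1/2 the expression is exactly \<psi>^2/2 -
  1/8, and |\<psi>| is at most 1/2.\<close>

lemma triangular_floor_bound:
  assumes "real n \<le> z" "z < real n + 1"
  shows "\<bar>real n * (real n + 1) / 2 - z ^ 2 / 2 + z * (z - n - 1/2)\<bar> \<le> 1"
proof -
  have "\<bar>z - n - 1/2\<bar> \<le> 1/2" using assms by linarith
  hence "(z - n - 1/2) ^ 2 \<le> (1/2) ^ 2" by (subst abs_le_square_iff [symmetric]) simp
  moreover have "(z - n - 1/2) ^ 2 \<ge> 0" by simp
  moreover have "real n * (real n + 1) / 2 - z ^ 2 / 2 + z * (z - n - 1/2) = (z - n - 1/2) ^ 2 / 2 - 1/8"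
    by (simp add: power2_eq_square field_simps)
  moreover have "(1/2 :: real) ^ 2 = 1/4" by (simp add: power2_eq_square)
  ultimately show ?thesis by linarith
qed

section \<open>Dirichlet's hyperbola method\<close>

text \<open>A lattice point with \<open>d * m \<le> M\<close> cannot have both coordinates above
  \<open>N\<close>, because \<open>M < (N + 1) ^ 2\<close>. So the points with
  \<open>d \<le> N\<close> and their mirror images cover the region; they overlap in the full square
  of side \<open>N\<close>, because \<open>N ^ 2 \<le> M\<close>. The rest is
  inclusion-exclusion.\<close>

lemma sum_divisors_hyperbola:
  fixes f :: "nat \<Rightarrow> real"
  assumes "N ^ 2 \<le> M" "M < (N + 1) ^ 2"
  shows "(\<Sum>n=1..M. \<Sum>d | d dvd n. f d) =
    (\<Sum>m=1..N. f m * real (M div m) + (\<Sum>d=1..M div m. f d)) - real N * (\<Sum>d=1..N. f d)"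
proof -
  define A where "A = (SIGMA d:{1..N}. {1..M div d})"
  define D where "D = {(d, m). 1 \<le> d \<and> 1 \<le> m \<and> d * m \<le> M}"
  have A: "A = {(d, m). 1 \<le> d \<and> d \<le> N \<and> 1 \<le> m \<and> d * m \<le> M}"
    unfolding A_def by (auto simp: less_eq_div_iff_mult_less_eq mult.commute)
  have [simp]: "finite A" unfolding A_def by simp
  have D: "D = A \<union> prod.swap ` A"
  proof -
    have "d \<le> N \<or> m \<le> N" if "d * m \<le> M" for d m
    proof (rule ccontr)
      assume "\<not> (d \<le> N \<or> m \<le> N)"
      hence "(N + 1) * (N + 1) \<le> d * m" by (intro mult_mono) auto
      with that assms(2) show False by (simp add: power2_eq_square)
    qed
    thus ?thesis unfolding A D_def by (force simp: image_iff mult.commute)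
  qed
  have int: "A \<inter> prod.swap ` A = {1..N} \<times> {1..N}"
  proof -
    have "d * m \<le> M" if "d \<le> N" "m \<le> N" for d m
      using mult_mono[OF that] assms(1) by (simp add: power2_eq_square)
    thus ?thesis unfolding A by (force simp: image_iff mult.commute)
  qed
  have "(\<Sum>n=1..M. \<Sum>d | d dvd n. f d) = (\<Sum>(n, d)\<in>(SIGMA n:{1..M}. {d. d dvd n}). f d)"
    by (intro sum.Sigma) auto
  also have "\<dots> = (\<Sum>(d, m)\<in>D. f d)"
    by (rule sum.reindex_bij_witness[of _ "\<lambda>(d, m). (d * m, d)" "\<lambda>(n, d). (d, n div d)"])
       (auto simp: D_def dvd_div_eq_0_iff Suc_le_eq intro: dvd_pos_nat)
  also have "\<dots> = (\<Sum>(d, m)\<in>A. f d) + (\<Sum>(d, m)\<in>prod.swap ` A. f d) - (\<Sum>(d, m)\<in>{1..N} \<times> {1..N}. f d)"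
    using sum.union_inter[of A "prod.swap ` A" "\<lambda>(d, m). f d"] unfolding D int by simp
  also have "(\<Sum>(d, m)\<in>A. f d) = (\<Sum>m=1..N. f m * real (M div m))"
    unfolding A_def by (subst sum.Sigma [symmetric]) (auto simp: mult.commute)
  \<comment> \<open>On the mirrored half the bounded coordinate is the cofactor, so the weight
    \<open>f\<close> is summed in the inner sum.\<close>
  also have "(\<Sum>(d, m)\<in>prod.swap ` A. f d) = (\<Sum>(m, d)\<in>A. f d)"
    by (subst sum.reindex) (auto simp: case_prod_unfold)
  also have "\<dots> = (\<Sum>m=1..N. \<Sum>d=1..M div m. f d)"
    unfolding A_def by (subst sum.Sigma [symmetric]) auto
  also have "(\<Sum>(d, m)\<in>{1..N} \<times> {1..N}. f d) = real N * (\<Sum>d=1..N. f d)"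
    by (subst sum.Sigma [symmetric]) (auto simp: sum_distrib_left)
  finally show ?thesis by (simp add: sum.distrib)
qed

section \<open>The weight 1/d - d/X and a single term of the hyperbola sum\<close>

text \<open>The involution d -> n/d on the divisors of \<open>n\<close>. It supplies the part 1/d of
  the weight; the part -d/X comes directly from the definition of \<open>sigma\<close>.\<close>

lemma sigma_over_eq_sum_inverse_divisors:
  assumes "n \<ge> 1"
  shows "real (sigma n) / n = (\<Sum>d | d dvd n. 1 / real d)"
proof -
  have "(\<Sum>d | d dvd n. 1 / real d) = (\<Sum>d | d dvd n. real d / n)"
  proof (rule sum.reindex_bij_witness[of _ "\<lambda>d. n div d" "\<lambda>d. n div d"])
    fix d assume "d \<in> {d. d dvd n}"
    thus "real (n div d) / n = 1 / d" using assms by (simp add: real_of_nat_div)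
  qed (use assms in \<open>auto simp: div_dvd_iff_mult\<close>)
  thus ?thesis by (simp add: sigma_def sum_divide_distrib)
qed

lemma sum_inverse_minus_linear:
  "(\<Sum>d=1..n. 1 / real d - d / X) = harm n - real n * (real n + 1) / (2 * X)"
  by (induction n) (simp_all add: harm_Suc inverse_eq_divide harm_expand add_divide_distrib algebra_simps)

text \<open>
  With \<open>\<psi> = {X/m} - 1/2\<close>, the first product contributes \<open>- \<psi> (1/m - m/X)\<close> and the remaining terms
  contribute \<open>\<psi> (1/m - m/X)\<close>, so the oscillating parts cancel.
\<close>
lemma hyperbola_term_bound:
  assumes "m \<ge> 1" "real m ^ 2 \<le> X" "real n \<le> X / m" "X / m < real n + 1"
  shows "\<bar>(1 / m - m / X) * n + (harm n - real n * (real n + 1) / (2 * X)) -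
    (X / (2 * real m ^ 2) - 1 - 1 / (2 * real m) + real m / (2 * X) + ln X - ln (real m) + euler_mascheroni)\<bar> \<le> 3 / X"
proof -
  define z where "z = X / m"
  define h where "h = harm n - ln z - euler_mascheroni + (z - n - 1/2) / z"
  define e where "e = real n * (real n + 1) / 2 - z ^ 2 / 2 + z * (z - n - 1/2)"
  have m: "real m > 0" using assms by simp
  have "real m * 1 \<le> real m * real m" using assms(1) by (intro mult_left_mono) auto
  hence mX: "real m \<le> X" using assms(2) by (simp add: power2_eq_square)
  hence X: "X > 0" using m by linarith
  have z: "z \<ge> 1" unfolding z_def using mX m by simp
  have "n \<ge> 1" using assms(4) z unfolding z_def by linarith
  hence "\<bar>h\<bar> \<le> 2 / z ^ 2"
    unfolding h_def using assms by (intro harm_floor_bound) (auto simp: z_def)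
  \<comment> \<open>The error grows with \<open>m\<close>; staying on the side
    \<open>m ^ 2 \<le> X\<close> of the hyperbola keeps it of order 1/X.\<close>
  also have "\<dots> = 2 * (m ^ 2 / X) / X"
    unfolding z_def using m X by (simp add: field_simps power2_eq_square)
  also have "\<dots> \<le> 2 * 1 / X"
    using assms(2) X by (intro divide_right_mono mult_left_mono) auto
  finally have h: "\<bar>h\<bar> \<le> 2 / X" by simp
  have "\<bar>e\<bar> \<le> 1"
    unfolding e_def using assms by (intro triangular_floor_bound) (auto simp: z_def)
  hence e: "\<bar>e / X\<bar> \<le> 1 / X" using X by (simp add: divide_right_mono)
  have Xz: "X = z * m" unfolding z_def using m by simp
  have "ln z = ln X - ln m" unfolding z_def using m X by (simp add: ln_div)
  \<comment> \<open>An exact identity after \<open>X = z * m\<close>. The surviving sawtooth term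
    \<open>(z - n - 1/2) / z\<close> is the one that the harmonic number, through \<open>h\<close>,
    cancels.\<close>
  moreover have "(1 / m - m / X) * n - real n * (real n + 1) / (2 * X) -
      (X / (2 * real m ^ 2) - 1 - 1 / (2 * real m) + real m / (2 * X)) = (z - n - 1/2) / z - e / X"
    unfolding e_def Xz using m z by (simp add: divide_simps) algebra
  ultimately have "(1 / m - m / X) * n + (harm n - real n * (real n + 1) / (2 * X)) -
    (X / (2 * real m ^ 2) - 1 - 1 / (2 * real m) + real m / (2 * X) + ln X - ln (real m) + euler_mascheroni) = h - e / X"
    unfolding h_def by (simp add: algebra_simps)
  moreover have "3 / X = 2 / X + 1 / X" by simp
  ultimately show ?thesis using h e by linarith
qed

section \<open>The integral over a finite range\<close>

text \<open>Each \<open>n \<le> X\<close> contributes to the step function on [n, X] only, where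
  1/t^2 integrates to 1/n - 1/X. The smooth part \<open>- (zeta 2 / 2) + 1 / (2 * t)\<close> is
  integrated separately.\<close>

lemma has_integral_sigma_error:
  assumes "X \<ge> 1"
  shows "((\<lambda>t. (sigma_error t + t / 2) / t\<^sup>2) has_integral
    (\<Sum>n=1..nat \<lfloor>X\<rfloor>. real (sigma n) * (1 / n - 1 / X)) - zeta 2 / 2 * (X - 1) + ln X / 2) {1..X}"
proof -
  let ?M = "nat \<lfloor>X\<rfloor>"
  have inv_sq: "((\<lambda>t. if t \<in> {real n..X} then 1 / t\<^sup>2 else 0) has_integral (1 / n - 1 / X)) {1..X}"
    if "n \<in> {1..?M}" for n
  proof -
    have n: "1 \<le> real n" "real n \<le> X" using that assms by (auto simp: le_nat_iff le_floor_iff)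
    have "((\<lambda>t. 1 / t\<^sup>2) has_integral (- 1 / X - (- 1 / n))) {real n..X}"
      using n by (intro fundamental_theorem_of_calculus)
        (auto intro!: derivative_eq_intros simp: has_real_derivative_iff_has_vector_derivative [symmetric] power2_eq_square)
    thus ?thesis using n by (subst has_integral_restrict) auto
  qed
  have main: "((\<lambda>t. \<Sum>n=1..?M. real (sigma n) * (if t \<in> {real n..X} then 1 / t\<^sup>2 else 0)) has_integral
    (\<Sum>n=1..?M. real (sigma n) * (1 / n - 1 / X))) {1..X}"
    by (intro has_integral_sum has_integral_mult_right inv_sq) auto
  have "((\<lambda>t. - (zeta 2 / 2) + 1 / (2 * t)) has_integral
      (- (zeta 2 / 2) * X + ln X / 2 - (- (zeta 2 / 2) * 1 + ln 1 / 2))) {1..X}"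
    using assms by (intro fundamental_theorem_of_calculus)
      (auto intro!: derivative_eq_intros simp: has_real_derivative_iff_has_vector_derivative [symmetric])
  from has_integral_add[OF main this]
  have "((\<lambda>t. (\<Sum>n=1..?M. real (sigma n) * (if t \<in> {real n..X} then 1 / t\<^sup>2 else 0)) + (- (zeta 2 / 2) + 1 / (2 * t)))
    has_integral (\<Sum>n=1..?M. real (sigma n) * (1 / n - 1 / X)) - zeta 2 / 2 * (X - 1) + ln X / 2) {1..X}"
    by (rule has_integral_eq_rhs) (simp add: algebra_simps diff_divide_distrib)
  thus ?thesis
  proof (rule has_integral_eq [rotated])
    fix t assume t: "t \<in> {1..X}"
    have "(\<Sum>n=1..?M. real (sigma n) * (if t \<in> {real n..X} then 1 / t\<^sup>2 else 0)) =
      (\<Sum>n | 1 \<le> n \<and> real n \<le> t. real (sigma n) * (1 / t\<^sup>2))"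
      using t by (intro sum.mono_neutral_cong_right) (auto simp: le_nat_iff le_floor_iff)
    also have "\<dots> = (\<Sum>n | 1 \<le> n \<and> real n \<le> t. real (sigma n)) / t\<^sup>2"
      by (simp add: sum_divide_distrib)
    finally show "(\<Sum>n=1..?M. real (sigma n) * (if t \<in> {real n..X} then 1 / t\<^sup>2 else 0)) +
      (- (zeta 2 / 2) + 1 / (2 * t)) = (sigma_error t + t / 2) / t\<^sup>2"
      unfolding sigma_error_def using t by (simp add: field_simps power2_eq_square)
  qed
qed

section \<open>The limit as X tends to infinity\<close>

lemma tendsto_sum_sigma:
  "((\<lambda>X. (\<Sum>n=1..nat \<lfloor>X\<rfloor>. real (sigma n) * (1 / n - 1 / X)) - zeta 2 / 2 * X + ln X / 2)
    \<longlongrightarrow> (1 - euler_mascheroni - ln (2 * pi)) / 2) at_top"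
proof -
  define N where "N X = nat \<lfloor>sqrt X\<rfloor>" for X :: real
  define q where "q X = real (N X) / sqrt X" for X :: real
  define f where "f X d = 1 / real d - d / X" for X :: real and d :: nat
  define k where "k X m = nat \<lfloor>X\<rfloor> div m" for X :: real and m :: nat
  define F where "F X n = harm n - real n * (real n + 1) / (2 * X)" for X :: real and n :: nat
  \<comment> \<open>\<open>R\<close>, \<open>a\<close>, \<open>b\<close>, \<open>d\<close> and \<open>r\<close> tend to \<open>0\<close>; \<open>c\<close> is the Stirling term. In \<open>r\<close> the first-order parts
    in \<open>\<surd>X - N\<close> cancel.\<close>
  define R where "R X = (\<Sum>m=1..N X. f X m * k X m + F X (k X m) -
    (X / (2 * real m ^ 2) - 1 - 1 / (2 * real m) + real m / (2 * X) + ln X - ln (real m) + euler_mascheroni))" for X :: real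
  define a where "a X = X / 2 * ((\<Sum>m=1..N X. 1 / real m ^ 2) - zeta 2 + 1 / N X - 1 / (2 * real (N X) ^ 2))" for X :: real
  define b where "b X = harm (N X) - ln (real (N X)) - euler_mascheroni" for X :: real
  define c where "c X = ln (fact (N X)) - (N X + 1/2) * ln (real (N X)) + N X" for X :: real
  define d where "d X = N X * (F X (N X) - ln (sqrt X) - euler_mascheroni + 1/2)" for X :: real
  define r where "r X = (real (N X) ^ 2 - X) / (2 * real (N X)) + N X * ln (sqrt X / N X)" for X :: real
  have N: "N X \<ge> 1" "real (N X) \<le> sqrt X" "sqrt X < real (N X) + 1" "real (N X) ^ 2 \<le> X" if "X \<ge> 1" for X
  proof -
    have "sqrt X \<ge> 1" using that by simp
    thus 1: "N X \<ge> 1" "real (N X) \<le> sqrt X" "sqrt X < real (N X) + 1"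
      unfolding N_def by (auto simp: le_nat_iff le_floor_iff)
    have "real (N X) ^ 2 \<le> sqrt X ^ 2" using 1(2) by (intro power_mono) auto
    thus "real (N X) ^ 2 \<le> X" using that by simp
  qed
  have k: "real (k X m) \<le> X / m" "X / m < real (k X m) + 1" if "X \<ge> 1" "m \<ge> 1" for X m
  proof -
    \<comment> \<open>Nested floors: rounding \<open>X\<close> down before dividing by the integer
      \<open>m\<close> does not change the integer part of the quotient.\<close>
    have "\<lfloor>X / m\<rfloor> = int (k X m)"
      using floor_divide_real_eq_div[of "int m" X] that unfolding k_def by (simp add: zdiv_int)
    thus "real (k X m) \<le> X / m" "X / m < real (k X m) + 1" by (auto simp: floor_eq_iff)
  qed
  have N_le: "nat \<lfloor>X\<rfloor> < (N X + 1) ^ 2" "N X ^ 2 \<le> nat \<lfloor>X\<rfloor>" if "X \<ge> 1" for X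
  proof -
    have "sqrt X ^ 2 < (real (N X) + 1) ^ 2" using N(3)[OF that] that by (intro power_strict_mono) auto
    hence "X < real ((N X + 1) ^ 2)" using that by (simp add: add_ac)
    moreover have "real (nat \<lfloor>X\<rfloor>) \<le> X" using that by simp
    ultimately have "real (nat \<lfloor>X\<rfloor>) < real ((N X + 1) ^ 2)" by linarith
    thus "nat \<lfloor>X\<rfloor> < (N X + 1) ^ 2" by (simp only: of_nat_less_iff)
    show "N X ^ 2 \<le> nat \<lfloor>X\<rfloor>" using N(4)[OF that] that by (simp add: le_nat_iff le_floor_iff)
  qed
  have sum_eq: "(\<Sum>n=1..nat \<lfloor>X\<rfloor>. real (sigma n) * (1 / n - 1 / X)) =
    (\<Sum>m=1..N X. f X m * k X m + F X (k X m)) - N X * F X (N X)" if "X \<ge> 1" for X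
  proof -
    have "real (sigma n) * (1 / n - 1 / X) = (\<Sum>d | d dvd n. f X d)" if "n \<ge> 1" for n
    proof -
      have "real (sigma n) * (1 / n - 1 / X) = real (sigma n) / n - real (sigma n) / X"
        by (simp add: algebra_simps)
      also have "real (sigma n) / X = (\<Sum>d | d dvd n. real d / X)"
        by (simp add: sigma_def sum_divide_distrib)
      finally show ?thesis
        using sigma_over_eq_sum_inverse_divisors[OF that] by (simp add: f_def sum_subtractf)
    qed
    hence "(\<Sum>n=1..nat \<lfloor>X\<rfloor>. real (sigma n) * (1 / n - 1 / X)) =
      (\<Sum>n=1..nat \<lfloor>X\<rfloor>. \<Sum>d | d dvd n. f X d)" by simp
    moreover have "(\<Sum>d=1..n. f X d) = F X n" for n
      unfolding f_def F_def by (rule sum_inverse_minus_linear)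
    ultimately show ?thesis
      using sum_divisors_hyperbola[OF N_le(2,1)[OF that], of "f X"] by (simp add: k_def)
  qed
  \<comment> \<open>An exact identity. As \<open>q\<close> tends to 1, the two quarter terms give
    1/2; half a harmonic number leaves \<open>- euler_mascheroni / 2\<close>, and \<open>c\<close>
    gives \<open>- ln (2 * pi) / 2\<close>.\<close>
  have decomp: "(\<Sum>n=1..nat \<lfloor>X\<rfloor>. real (sigma n) * (1 / n - 1 / X)) - zeta 2 / 2 * X + ln X / 2 =
    R X + a X - b X / 2 - c X - d X - euler_mascheroni / 2 + 1 / q X ^ 2 / 4 +
    (q X ^ 2 + q X * (1 / sqrt X)) / 4 + r X - ln (q X)" if X: "X \<ge> 1" for X :: real
  proof -
    define M where "M = real (N X)"
    define y where "y = sqrt X"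
    have M: "M \<ge> 1" "y \<ge> 1" and Xy: "X = y ^ 2"
      using N[OF X] X unfolding M_def y_def by auto
    have lnfact: "(\<Sum>m=1..n. ln (real m)) = ln (fact n)" for n
      by (induction n) (simp_all add: ln_mult)
    have gauss: "(\<Sum>m=1..n. real m) = real n * (real n + 1) / 2" for n
      by (induction n) (simp_all add: field_simps)
    have "(\<Sum>m=1..N X. X / (2 * real m ^ 2) - 1 - 1 / (2 * real m) + real m / (2 * X) + ln X - ln (real m) + euler_mascheroni) =
       X / 2 * (\<Sum>m=1..N X. 1 / real m ^ 2) - M - harm (N X) / 2 + (\<Sum>m=1..N X. real m) / (2 * X) +
       M * ln X - (\<Sum>m=1..N X. ln (real m)) + M * euler_mascheroni"
      unfolding M_def harm_def
      by (simp add: sum.distrib sum_subtractf sum_distrib_left sum_divide_distrib inverse_eq_divide mult.commute)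
    hence main: "(\<Sum>m=1..N X. f X m * k X m + F X (k X m)) =
       R X + (X / 2 * (\<Sum>m=1..N X. 1 / real m ^ 2) - M - harm (N X) / 2 + M * (M + 1) / (4 * X) +
       M * ln X - ln (fact (N X)) + M * euler_mascheroni)"
      unfolding R_def lnfact gauss by (simp add: sum_subtractf M_def)
    have lnX: "ln X = 2 * ln y" unfolding Xy using M by (simp add: ln_realpow)
    have qM: "q X = M / y" unfolding q_def M_def y_def ..
    have lnq: "ln (q X) = ln M - ln y" "ln (sqrt X / N X) = ln y - ln M"
      unfolding q_def M_def [symmetric] y_def [symmetric] using M by (simp_all add: ln_div)
    have q: "1 / q X ^ 2 = X / M ^ 2" "q X ^ 2 + q X * (1 / sqrt X) = M * (M + 1) / X"
      unfolding qM y_def [symmetric] unfolding Xy using M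
      by (simp_all add: field_simps power2_eq_square)
    have MF: "M * F X (N X) = d X + M * ln y + M * euler_mascheroni - M / 2"
      unfolding d_def M_def [symmetric] y_def [symmetric] by (simp add: algebra_simps)
    have a: "a X = X / 2 * (\<Sum>m=1..N X. 1 / real m ^ 2) - zeta 2 / 2 * X + X / (2 * M) - X / (4 * M ^ 2)"
      unfolding a_def M_def by (simp add: algebra_simps)
    have r: "r X = M / 2 - X / (2 * M) + M * (ln y - ln M)"
      unfolding r_def lnq(2) unfolding M_def [symmetric] using M by (simp add: field_simps power2_eq_square)
    show ?thesis
      unfolding sum_eq[OF X] main q r a lnq lnX b_def c_def M_def [symmetric] MF
      by (simp add: algebra_simps diff_divide_distrib)
  qed
  have N_lim: "filterlim N at_top at_top"
    unfolding N_def
    by (intro filterlim_compose[OF filterlim_nat_sequentially]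
        filterlim_compose[OF filterlim_floor_sequentially] sqrt_at_top)
  have ge1: "eventually (\<lambda>X. X \<ge> (1 :: real)) at_top" by (rule eventually_ge_at_top)
  have inv_sqrt: "((\<lambda>X. C / sqrt X) \<longlongrightarrow> 0) at_top" for C :: real by real_asymp
  have inv_N: "((\<lambda>X. C / real (N X)) \<longlongrightarrow> 0) at_top" for C :: real
    by (intro real_tendsto_divide_at_top[OF tendsto_const] filterlim_compose[OF filterlim_real_sequentially N_lim])
  have q_lim: "(q \<longlongrightarrow> 1) at_top"
  proof (rule tendsto_sandwich)
    show "eventually (\<lambda>X. 1 - 1 / sqrt X \<le> q X) at_top"
      using ge1
    proof eventually_elim
      case (elim X)
      have "(sqrt X - 1) / sqrt X \<le> N X / sqrt X"
        using N(3)[OF elim] elim by (intro divide_right_mono) auto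
      thus ?case unfolding q_def using elim by (simp add: diff_divide_distrib)
    qed
    show "eventually (\<lambda>X. q X \<le> 1) at_top"
      using ge1
    proof eventually_elim
      case (elim X)
      thus ?case unfolding q_def using N(2)[OF elim] by (simp add: field_simps)
    qed
    show "((\<lambda>X. 1 - 1 / sqrt X) \<longlongrightarrow> 1) at_top" by real_asymp
  qed simp
  have R_lim: "(R \<longlongrightarrow> 0) at_top"
  proof (rule Lim_null_comparison[OF _ inv_sqrt[of 3]])
    show "eventually (\<lambda>X. norm (R X) \<le> 3 / sqrt X) at_top"
      using ge1
    proof eventually_elim
      case (elim X)
      \<comment> \<open>At most \<open>sqrt X\<close> terms, each of size at most 3/X.\<close>
      have "norm (R X) \<le> (\<Sum>m=1..N X. 3 / X)"
        unfolding R_def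
      proof (rule sum_norm_le)
        fix m assume m: "m \<in> {1..N X}"
        hence "real m ^ 2 \<le> real (N X) ^ 2" by (intro power_mono) auto
        with N(4)[OF elim] have mX: "real m ^ 2 \<le> X" by linarith
        show "norm (f X m * k X m + F X (k X m) -
          (X / (2 * real m ^ 2) - 1 - 1 / (2 * real m) + real m / (2 * X) + ln X - ln (real m) + euler_mascheroni)) \<le> 3 / X"
          unfolding f_def F_def real_norm_def
          using m mX k[OF elim, of m] by (intro hyperbola_term_bound) auto
      qed
      also have "\<dots> = N X * (3 / X)" by simp
      also have "\<dots> \<le> sqrt X * (3 / X)" using N(2)[OF elim] elim by (intro mult_right_mono) auto
      also have "\<dots> = 3 / sqrt X" using elim by (simp add: field_simps)
      finally show ?case .
    qed
  qed
  have d_lim: "(d \<longlongrightarrow> 0) at_top"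
  proof (rule Lim_null_comparison[OF _ inv_sqrt[of 3]])
    show "eventually (\<lambda>X. norm (d X) \<le> 3 / sqrt X) at_top"
      using ge1
    proof eventually_elim
      case (elim X)
      define M where "M = real (N X)"
      define y where "y = sqrt X"
      have M: "M \<ge> 1" "M \<le> y" "y < M + 1" and Xy: "X = y ^ 2"
        using N[OF elim] elim unfolding M_def y_def by auto
      \<comment> \<open>Both floor expansions at \<open>z = sqrt X\<close>. Since
        \<open>X = y ^ 2\<close>, each contributes the sawtooth term
        \<open>(y - M - 1/2) / y\<close>, and in \<open>F\<close> they cancel.\<close>
      define h where "h = harm (N X) - ln y - euler_mascheroni + (y - M - 1/2) / y"
      define e where "e = M * (M + 1) / 2 - y ^ 2 / 2 + y * (y - M - 1/2)"
      have "\<bar>h\<bar> \<le> 2 / y ^ 2"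
        unfolding h_def M_def using N[OF elim] by (intro harm_floor_bound) (auto simp: y_def)
      hence h: "\<bar>h\<bar> \<le> 2 / X" by (simp only: Xy)
      have "\<bar>e\<bar> \<le> 1"
        unfolding e_def M_def using N[OF elim] by (intro triangular_floor_bound) (auto simp: y_def)
      hence e: "\<bar>e / X\<bar> \<le> 1 / X" using elim by (simp add: divide_right_mono)
      have "M * (M + 1) / (2 * X) = 1 / 2 - (y - M - 1/2) / y + e / X"
        unfolding e_def Xy using M by (simp add: divide_simps) algebra
      hence "F X (N X) = h - e / X + ln y + euler_mascheroni - 1/2"
        unfolding F_def h_def M_def by linarith
      hence "d X = M * (h - e / X)"
        unfolding d_def M_def y_def by simp
      moreover have "\<bar>h - e / X\<bar> \<le> 3 / X"
      proof -
        have "3 / X = 2 / X + 1 / X" by simp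
        thus ?thesis using h e by linarith
      qed
      ultimately have "norm (d X) \<le> M * (3 / X)"
        using M unfolding real_norm_def by (simp only: abs_mult) (intro mult_mono; simp)
      also have "\<dots> \<le> y * (3 / X)" using M elim by (intro mult_right_mono) auto
      also have "\<dots> = 3 / sqrt X" using elim unfolding y_def by (simp add: field_simps)
      finally show ?case .
    qed
  qed
  have a_lim: "(a \<longlongrightarrow> 0) at_top"
  proof (rule Lim_null_comparison)
    show "eventually (\<lambda>X. norm (a X) \<le> 1 / q X ^ 2 * ((1/2) / N X)) at_top"
      using ge1
    proof eventually_elim
      case (elim X)
      \<comment> \<open>The factor \<open>X / 2\<close> has order \<open>N ^ 2\<close>, so a tail
        error of order \<open>1 / N ^ 3\<close> still leaves \<open>1 / N\<close>.\<close>
      have "norm (a X) \<le> X / 2 * (1 / N X ^ 3)"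
        unfolding a_def norm_mult using zeta_2_tail_bound[OF N(1)[OF elim]] elim
        by (intro mult_mono) auto
      also have "\<dots> = 1 / q X ^ 2 * ((1/2) / N X)"
        using N(1)[OF elim] elim unfolding q_def by (simp add: field_simps power2_eq_square power3_eq_cube)
      finally show ?case .
    qed
    have "((\<lambda>X. 1 / q X ^ 2 * ((1/2) / N X)) \<longlongrightarrow> 1 / 1 ^ 2 * 0) at_top"
      by (intro tendsto_intros q_lim inv_N) auto
    thus "((\<lambda>X. 1 / q X ^ 2 * ((1/2) / N X)) \<longlongrightarrow> 0) at_top" by simp
  qed
  have r_lim: "(r \<longlongrightarrow> 0) at_top"
  proof (rule Lim_null_comparison[OF _ inv_N[of 2]])
    show "eventually (\<lambda>X. norm (r X) \<le> 2 / N X) at_top"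
      using ge1
    proof eventually_elim
      case (elim X)
      define M where "M = real (N X)"
      define h where "h = (sqrt X - M) / M"
      have M: "M \<ge> 1" "M \<le> sqrt X" "sqrt X < M + 1"
        using N[OF elim] unfolding M_def by auto
      have h: "0 \<le> h" "h \<le> 1 / M" unfolding h_def using M by (auto intro: divide_right_mono)
      have "1 / M \<le> 1" using M by simp
      hence h1: "h \<le> 1" using h by linarith
      \<comment> \<open>In terms of \<open>h\<close> the linear parts of the quotient and of the
        logarithm are \<open>- M * h\<close> and \<open>M * h\<close>. What remains is of order
        \<open>M * h ^ 2\<close>, hence of order \<open>1 / M\<close>.\<close>
      have y: "sqrt X = M * (1 + h)" unfolding h_def using M by (simp add: field_simps)
      hence y': "sqrt X / M = 1 + h" using M by simp
      have "X = (M * (1 + h)) ^ 2" using elim unfolding y [symmetric] by simp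
      hence "(M ^ 2 - X) / (2 * M) = - M * (h + h ^ 2 / 2)"
        using M by (simp add: field_simps power2_eq_square)
      hence r: "r X = M * (ln (1 + h) - h - h ^ 2 / 2)"
        unfolding r_def M_def [symmetric] y' by (simp add: algebra_simps)
      have "\<bar>ln (1 + h) - h\<bar> \<le> h ^ 2"
        by (rule abs_ln_one_plus_x_minus_x_bound_nonneg[OF h(1) h1])
      moreover have "h ^ 2 \<ge> 0" by simp
      ultimately have "\<bar>ln (1 + h) - h - h ^ 2 / 2\<bar> \<le> 2 * h ^ 2" by linarith
      also have "\<dots> \<le> 2 * (1 / M) ^ 2" using h by (intro mult_left_mono power_mono) auto
      finally have "norm (r X) \<le> M * (2 * (1 / M) ^ 2)"
        unfolding r norm_mult using M by (intro mult_mono) auto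
      also have "\<dots> = 2 / N X" using M by (simp add: M_def power2_eq_square)
      finally show ?case .
    qed
  qed
  have b_lim: "(b \<longlongrightarrow> 0) at_top"
  proof -
    have "(\<lambda>n. harm n - ln (real n) - euler_mascheroni) \<longlonglongrightarrow> euler_mascheroni - euler_mascheroni"
      by (intro tendsto_intros euler_mascheroni_LIMSEQ)
    from filterlim_compose[OF this N_lim] show ?thesis unfolding b_def by simp
  qed
  have c_lim: "(c \<longlongrightarrow> ln (2 * pi) / 2) at_top"
    using filterlim_compose[OF tendsto_ln_fact_stirling N_lim] unfolding c_def by simp
  have "((\<lambda>X. R X + a X - b X / 2 - c X - d X - euler_mascheroni / 2 + 1 / q X ^ 2 / 4 +
      (q X ^ 2 + q X * (1 / sqrt X)) / 4 + r X - ln (q X)) \<longlongrightarrow>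
      0 + 0 - 0 / 2 - ln (2 * pi) / 2 - 0 - euler_mascheroni / 2 + 1 / 1 ^ 2 / 4 +
      (1 ^ 2 + 1 * 0) / 4 + 0 - ln 1) at_top"
    by (intro tendsto_intros R_lim a_lim b_lim c_lim d_lim q_lim r_lim inv_sqrt) auto
  also have "0 + 0 - 0 / 2 - ln (2 * pi) / 2 - 0 - euler_mascheroni / 2 + 1 / 1 ^ 2 / 4 +
      (1 ^ 2 + 1 * 0) / 4 + 0 - ln 1 = (1 - euler_mascheroni - ln (2 * pi)) / (2 :: real)"
    by (simp add: field_simps)
  finally show ?thesis
    by (rule Lim_transform_eventually) (use ge1 in eventually_elim, simp only: decomp)
qed

theorem corollary1p2:
  shows "has_improper_integral (\<lambda>t. (sigma_error t + t / 2) / t\<^sup>2) 1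
           ((1 + zeta 2 - euler_mascheroni - ln (2 * pi)) / 2)"
  unfolding has_improper_integral_def
proof (intro conjI allI impI)
  fix X :: real assume "X \<ge> 1"
  thus "(\<lambda>t. (sigma_error t + t / 2) / t\<^sup>2) integrable_on {1..X}"
    using has_integral_sigma_error by blast
next
  \<comment> \<open>The extra \<open>zeta 2 / 2\<close> comes from the lower endpoint of the
    integral, through \<open>zeta 2 / 2 * (X - 1)\<close>.\<close>
  have "((\<lambda>X. (\<Sum>n=1..nat \<lfloor>X\<rfloor>. real (sigma n) * (1 / n - 1 / X)) - zeta 2 / 2 * X + ln X / 2 + zeta 2 / 2)
    \<longlongrightarrow> (1 - euler_mascheroni - ln (2 * pi)) / 2 + zeta 2 / 2) at_top"
    by (intro tendsto_add tendsto_const tendsto_sum_sigma)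
  also have "(1 - euler_mascheroni - ln (2 * pi)) / 2 + zeta 2 / 2 =
    (1 + zeta 2 - euler_mascheroni - ln (2 * pi)) / 2" by (simp add: field_simps)
  finally show "((\<lambda>X. integral {1..X} (\<lambda>t. (sigma_error t + t / 2) / t\<^sup>2)) \<longlongrightarrow>
      (1 + zeta 2 - euler_mascheroni - ln (2 * pi)) / 2) at_top"
  proof (rule Lim_transform_eventually)
    show "eventually (\<lambda>X. (\<Sum>n=1..nat \<lfloor>X\<rfloor>. real (sigma n) * (1 / n - 1 / X)) - zeta 2 / 2 * X + ln X / 2 + zeta 2 / 2 =
      integral {1..X} (\<lambda>t. (sigma_error t + t / 2) / t\<^sup>2)) at_top"
      using eventually_ge_at_top[of "1 :: real"]
    proof eventually_elim
      case (elim X)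
      show ?case using integral_unique[OF has_integral_sigma_error[OF elim]]
        by (simp add: algebra_simps diff_divide_distrib)
    qed
  qed
qed

end
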